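(* Let $h\in L^1(\mathbb{R})$ be real-valued, with Fourier transform $\hat h$ that (extends to) an entire function, and assume that for some $C,\gamma>0$ $$|\hat h(u)|\le C e^{-\gamma\left((\operatorname{Re}u)^2-(\operatorname{Im}u)^2\right)},\qquad u\in\mathbb{C}.$$ Then, for every $r>0$ and $y\ne0$, $$|I_r[\hat h](y)|\le\frac{C}{2\sqrt{\pi\gamma}}\,e^{-\frac{y^2}{4\gamma}}+\frac1\pi\left|\operatorname{Im}\left[e^{\mathrm{i}ry}\hat h(r)\right]\right||y|^{-1}+O(y^{-2}).$$
   Context: The Fourier transform is $\hat h(z)=\int_{\mathbb{R}}h(y)e^{-\mathrm{i}zy}\,dy$, and for $r>0$, $I_r[\hat h](y):=\frac1{2\pi}\int_{-r}^{r}\hat h(u)e^{\mathrm{i}uy}\,du$. $O(y^{-2})$ denotes a term bounded in absolute value by $Ky^{-2}$ with $K$ independent of $y$ (it may depend on $h$ and $r$). *)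

theory Defs
  imports "HOL-Complex_Analysis.Complex_Analysis"
begin

text \<open>The integral is a Bochner integral, hence \<open>0\<close> at those \<open>z\<close> for which the integrand is not
  integrable; for integrable \<open>h\<close> it is a genuine integral at every real \<open>z\<close>.\<close>

definition fourier_transform :: "(real \<Rightarrow> real) \<Rightarrow> complex \<Rightarrow> complex" where
  "fourier_transform h z =
     (LINT y|lebesgue. complex_of_real (h y) * exp (- (\<i> * z * complex_of_real y)))"

text \<open>The operator \<open>I\<^sub>r[F](y)\<close>; it only uses the values of \<open>F\<close> on the real segment \<open>[-r, r]\<close>.\<close>

definition truncated_inverse_fourier :: "real \<Rightarrow> (complex \<Rightarrow> complex) \<Rightarrow> real \<Rightarrow> complex" where
  "truncated_inverse_fourier r F y =
     complex_of_real (1 / (2 * pi)) *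
     (LINT u:{-r..r}|lebesgue. F (complex_of_real u) * exp (\<i> * complex_of_real u * complex_of_real y))"

end

theory Submission
  imports Defs "HOL-Probability.Distributions"
begin

text \<open>The integrand is entire, so the segment \<open>[-r, r]\<close> may be replaced by the other three sides of
  the rectangle of signed height \<open>s = y / (2 * \<gamma>)\<close>. This \<open>s\<close> minimises \<open>\<gamma> * s\<^sup>2 - s * y\<close>, and with it the
  horizontal side contributes the Gaussian term. On the vertical sides \<open>\<gamma> * t\<^sup>2 \<le> \<bar>t * y\<bar> / 2\<close>, so the
  factor \<open>exp (- t * y)\<close> wins over the growth of \<open>hhat\<close>; replacing \<open>hhat\<close> by its value at the real
  endpoint costs \<open>O(1 / y\<^sup>2)\<close>. What remains are the values at \<open>r\<close> and \<open>-r\<close>, which are complex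
  conjugates because \<open>h\<close> is real, so only an imaginary part survives.\<close>

text \<open>The integrand is positive, so enlarging the interval to the whole line only increases
  the integral. The total is read off from the normal density with variance
  \<open>1 / (2 * \<gamma>)\<close>, whose mass is 1.\<close>

lemma gaussian_integral_le:
  fixes \<gamma> r :: real
  assumes "\<gamma> > 0"
  shows "integral {-r..r} (\<lambda>x. exp (- \<gamma> * x\<^sup>2)) \<le> sqrt (pi / \<gamma>)"
proof -
  define s where "s = sqrt (1 / (2 * \<gamma>))"
  have s0: "s > 0"
    using assms by (simp add: s_def)
  have s2: "s\<^sup>2 = 1 / (2 * \<gamma>)"
    using assms by (simp add: s_def)
  have eq: "exp (- \<gamma> * x\<^sup>2) = sqrt (pi / \<gamma>) * normal_density 0 s x" for x
    using assms by (simp add: normal_density_def s2 field_simps real_sqrt_divide)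
  have "((\<lambda>x. sqrt (pi / \<gamma>) * normal_density 0 s x) has_integral sqrt (pi / \<gamma>) * 1) UNIV"
    using has_integral_integral_lborel[OF integrable_normal_density[OF s0]] s0
    by (intro has_integral_mult_right) simp
  then have hi: "((\<lambda>x. exp (- \<gamma> * x\<^sup>2)) has_integral sqrt (pi / \<gamma>)) UNIV"
    unfolding eq by simp
  have "integral {-r..r} (\<lambda>x. exp (- \<gamma> * x\<^sup>2)) \<le> integral UNIV (\<lambda>x. exp (- \<gamma> * x\<^sup>2))"
    using hi by (intro integral_subset_le integrable_continuous_real)
      (auto intro!: continuous_intros)
  then show ?thesis
    using hi by (simp add: integral_unique)
qed

text \<open>For small \<open>t\<close> the derivative of \<open>F\<close>, bounded on a compact
  disc, gives linear growth; for large \<open>t\<close> the triangle inequality suffices. The factor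
  \<open>\<bar>t\<bar>\<close> is the purpose: integrated against exponential decay of rate
  proportional to \<open>\<bar>y\<bar>\<close>, it turns an error of order
  \<open>1 / \<bar>y\<bar>\<close> into one of order \<open>1 / y\<^sup>2\<close>.\<close>

lemma entire_increment_bound:
  fixes F :: "complex \<Rightarrow> complex"
  assumes hol: "F holomorphic_on UNIV" and "\<gamma> > 0"
    and bd: "\<And>t::real. cmod (F (w + \<i> * t)) \<le> D * exp (\<gamma> * t\<^sup>2)"
  obtains M where "M \<ge> 0"
    "\<And>t::real. cmod (F (w + \<i> * t) - F w) \<le> M * \<bar>t\<bar> * exp (\<gamma> * t\<^sup>2)"
proof -
  have "continuous_on (cball w 1) (deriv F)"
    by (intro holomorphic_on_imp_continuous_on holomorphic_on_subset[OF holomorphic_deriv[OF hol]]) auto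
  then have "bounded (deriv F ` cball w 1)"
    by (intro compact_imp_bounded compact_continuous_image) auto
  then obtain B where B: "B > 0" "\<And>z. z \<in> cball w 1 \<Longrightarrow> cmod (deriv F z) \<le> B"
    unfolding bounded_pos by auto
  have D: "D \<ge> 0"
    using order_trans[OF norm_ge_zero bd[of 0]] by simp
  show thesis
  \<comment> \<open>\<open>B\<close> serves the unit disc around \<open>w\<close>; outside it,
    \<open>2 * D\<close> bounds both values of \<open>F\<close>, and the factor
    \<open>\<bar>t\<bar>\<close> exceeds 1.\<close>
  proof (rule that[of "B + 2 * D"])
    show "B + 2 * D \<ge> 0" using B(1) D by simp
  next
    fix t :: real
    have e1: "exp (\<gamma> * t\<^sup>2) \<ge> 1" using \<open>\<gamma> > 0\<close> by simp
    show "cmod (F (w + \<i> * t) - F w) \<le> (B + 2 * D) * \<bar>t\<bar> * exp (\<gamma> * t\<^sup>2)"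
    proof (cases "\<bar>t\<bar> \<le> 1")
      case True
      have "cmod (F (w + \<i> * t) - F w) \<le> B * cmod (w + \<i> * t - w)"
      proof (rule field_differentiable_bound[OF convex_cball _ B(2)])
        show "(F has_field_derivative deriv F z) (at z within cball w 1)" for z
          using holomorphic_derivI[OF hol open_UNIV] by (simp add: has_field_derivative_at_within)
      qed (use True in \<open>auto simp: dist_norm norm_mult\<close>)
      also have "\<dots> = B * \<bar>t\<bar> * 1" by (simp add: norm_mult)
      also have "\<dots> \<le> (B + 2 * D) * \<bar>t\<bar> * exp (\<gamma> * t\<^sup>2)"
        using B(1) D e1 by (intro mult_mono) auto
      finally show ?thesis .
    next
      case False
      have "cmod (F (w + \<i> * t) - F w) \<le> D * exp (\<gamma> * t\<^sup>2) + D * 1"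
        using bd[of t] bd[of 0] norm_triangle_ineq4[of "F (w + \<i> * t)" "F w"] by simp
      also have "\<dots> \<le> D * exp (\<gamma> * t\<^sup>2) + D * exp (\<gamma> * t\<^sup>2)"
        using D e1 by (intro add_left_mono mult_left_mono)
      also have "\<dots> = (2 * D) * 1 * exp (\<gamma> * t\<^sup>2)" by simp
      also have "\<dots> \<le> (B + 2 * D) * \<bar>t\<bar> * exp (\<gamma> * t\<^sup>2)"
        using B(1) D False by (intro mult_mono) auto
      finally show ?thesis .
    qed
  qed
qed

text \<open>With \<open>F\<close> frozen at \<open>w\<close>, the integral along the vertical side
  is elementary and equals the subtracted term. The remaining integrand is at most
  \<open>M * t * exp (- (t * \<bar>y\<bar> / 2))\<close> at distance \<open>t\<close> from
  \<open>w\<close>, whose integral over the half-line is \<open>4 * M / y\<^sup>2\<close>. The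
  constant is obtained before \<open>y\<close> and \<open>G\<close>, so it is uniform in
  both.\<close>

lemma vertical_side_bound:
  fixes F :: "complex \<Rightarrow> complex" and w :: complex and \<gamma> :: real
  assumes w: "Im w = 0" and hol: "F holomorphic_on UNIV" and \<gamma>: "\<gamma> > 0"
    and bd: "\<And>t::real. cmod (F (w + \<i> * t)) \<le> D * exp (\<gamma> * t\<^sup>2)"
  obtains M where "\<And>(y::real) G. y \<noteq> 0 \<Longrightarrow>
      (\<And>z. (G has_field_derivative F z * exp (\<i> * z * y)) (at z)) \<Longrightarrow>
      cmod (G (w + \<i> * (y / (2 * \<gamma>))) - G w
        - F w * exp (\<i> * w * y) * (\<i> * (1 - exp (- (y\<^sup>2 / (2 * \<gamma>)))) / y)) \<le> M / y\<^sup>2"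
proof -
  obtain M where M: "M \<ge> 0"
    "\<And>t::real. cmod (F (w + \<i> * t) - F w) \<le> M * \<bar>t\<bar> * exp (\<gamma> * t\<^sup>2)"
    using entire_increment_bound[OF hol \<gamma> bd] by blast
  show thesis
  proof (rule that[of "4 * M"])
    fix y :: real and G
    assume y: "y \<noteq> 0" and G: "\<And>z. (G has_field_derivative F z * exp (\<i> * z * y)) (at z)"
    define a where "a = \<bar>y\<bar>"
    define \<sigma> where "\<sigma> = sgn y"
    define T where "T = a / (2 * \<gamma>)"
    have a: "a > 0" and sy: "y = \<sigma> * a" and ss: "\<sigma> * \<sigma> = 1" and T: "T > 0"
      using y \<gamma> by (auto simp: a_def \<sigma>_def T_def sgn_if)
    have cs: "complex_of_real \<sigma> * complex_of_real \<sigma> = 1"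
      using ss by (metis of_real_1 of_real_mult)
    define A where "A = F w * exp (\<i> * w * y)"
    define \<psi> where "\<psi> t = G (w + \<i> * (\<sigma> * t)) - A * (\<i> * \<sigma> / a) * (1 - of_real (exp (- a * t)))" for t :: real
    define \<psi>' where "\<psi>' t = \<i> * \<sigma> * (exp (\<i> * w * y) * of_real (exp (- a * t)))
        * (F (w + \<i> * (\<sigma> * t)) - F w)" for t :: real
    define \<phi> where "\<phi> t = - M * (2 * t / a + 4 / a\<^sup>2) * exp (- (t * a / 2))" for t :: real
    have d\<psi>: "(\<psi> has_vector_derivative \<psi>' t) (at t)" for t
    proof -
      have "((\<lambda>t. w + \<i> * (\<sigma> * of_real t)) has_vector_derivative \<i> * \<sigma>) (at t)"
        by (auto intro!: derivative_eq_intros simp: has_vector_derivative_def fun_eq_iff scaleR_conv_of_real mult_ac)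
      from field_vector_diff_chain_at[OF this G]
      have 1: "((\<lambda>t. G (w + \<i> * (\<sigma> * of_real t))) has_vector_derivative
          \<i> * \<sigma> * (F (w + \<i> * (\<sigma> * t)) * exp (\<i> * (w + \<i> * (\<sigma> * t)) * y))) (at t)"
        by (simp add: o_def)
      have "((\<lambda>t. exp (- a * t)) has_real_derivative - a * exp (- a * t)) (at t)"
        by (auto intro!: derivative_eq_intros)
      from has_vector_derivative_of_real[OF this]
      have 2: "((\<lambda>t. A * (\<i> * \<sigma> / a) * (1 - complex_of_real (exp (- a * t)))) has_vector_derivative
          A * (\<i> * \<sigma> / a) * (0 - of_real (- a * exp (- a * t)))) (at t)"
        by (intro has_vector_derivative_mult_right has_vector_derivative_diff has_vector_derivative_const)
      \<comment> \<open>Since \<open>\<sigma> * y = a\<close>, the exponential decays like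
        \<open>exp (- a * t)\<close> for either sign of \<open>y\<close>.\<close>
      have "exp (\<i> * (w + \<i> * (\<sigma> * t)) * y) = exp (\<i> * w * y) * exp (of_real (- a * t))"
      proof -
        have "\<i> * (w + \<i> * (\<sigma> * t)) * y = \<i> * w * y + (\<i> * \<i>) * (complex_of_real \<sigma> * \<sigma>) * (a * t)"
          unfolding sy by (simp add: algebra_simps)
        then show ?thesis using cs by (simp add: exp_diff exp_minus divide_inverse)
      qed
      then have "\<i> * \<sigma> * (F (w + \<i> * (\<sigma> * t)) * exp (\<i> * (w + \<i> * (\<sigma> * t)) * y))
          - A * (\<i> * \<sigma> / a) * (0 - of_real (- a * exp (- a * t))) = \<psi>' t"
        using a by (simp add: \<psi>'_def A_def flip: exp_of_real) (simp add: algebra_simps)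
      with has_vector_derivative_diff[OF 1 2] show ?thesis
        unfolding \<psi>_def by simp
    qed
    have d\<phi>: "(\<phi> has_vector_derivative M * t * exp (- (t * a / 2))) (at t)" for t
      unfolding has_real_derivative_iff_has_vector_derivative[symmetric] \<phi>_def using a
      by (auto intro!: derivative_eq_intros simp: field_simps power2_eq_square)
    have "norm (\<psi> T - \<psi> 0) \<le> \<phi> T - \<phi> 0"
    proof (rule differentiable_bound_general[OF T _ _ d\<psi> d\<phi>])
      show "continuous_on {0..T} \<psi>" "continuous_on {0..T} \<phi>"
        using d\<psi> d\<phi> by (auto intro!: continuous_at_imp_continuous_on has_vector_derivative_continuous)
    next
      fix t assume t: "0 < t" "t < T"
      have as: "\<bar>\<sigma>\<bar> = 1" using y by (simp add: \<sigma>_def abs_sgn_eq)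
      have e: "norm (exp (\<i> * w * y)) = 1" using w by (simp add: norm_exp_eq_Re)
      have st: "(\<sigma> * t)\<^sup>2 = t\<^sup>2" using ss by (simp add: power2_eq_square)
      \<comment> \<open>The height \<open>T\<close> enters here: up to it, the growth
        \<open>exp (\<gamma> * t\<^sup>2)\<close> uses up at most half of the decay rate
        \<open>a\<close>.\<close>
      have "\<gamma> * t \<le> a / 2"
        using t \<gamma> by (simp add: T_def field_simps)
      then have q: "\<gamma> * t\<^sup>2 \<le> t * a / 2"
        using mult_left_mono[of "\<gamma> * t" "a / 2" t] t by (simp add: power2_eq_square mult_ac)
      have "norm (\<psi>' t) = exp (- a * t) * cmod (F (w + \<i> * (\<sigma> * t)) - F w)"
        unfolding \<psi>'_def norm_mult e by (simp add: as)
      also have "\<dots> \<le> exp (- a * t) * (M * t * exp (\<gamma> * t\<^sup>2))"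
        using M(2)[of "\<sigma> * t"] t as st by (intro mult_left_mono) (auto simp: abs_mult)
      also have "\<dots> = M * t * exp (\<gamma> * t\<^sup>2 - a * t)"
        by (simp add: exp_diff exp_minus field_simps)
      also have "\<dots> \<le> M * t * exp (- (t * a / 2))"
        using M(1) t q by (intro mult_left_mono) (auto simp: algebra_simps)
      finally show "norm (\<psi>' t) \<le> M * t * exp (- (t * a / 2))" .
    qed
    also have "\<dots> \<le> 4 * M / y\<^sup>2"
    proof -
      have "\<phi> T \<le> 0" using M(1) T a by (simp add: \<phi>_def)
      then show ?thesis by (simp add: \<phi>_def a_def mult.commute)
    qed
    also have "\<psi> T - \<psi> 0 = G (w + \<i> * (y / (2 * \<gamma>))) - G w
        - F w * exp (\<i> * w * y) * (\<i> * (1 - exp (- (y\<^sup>2 / (2 * \<gamma>)))) / y)"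
    proof -
      have "complex_of_real \<sigma> / a = 1 / y"
        using cs y by (auto simp: a_def \<sigma>_def sgn_if)
      moreover have "\<sigma> * T = y / (2 * \<gamma>)" by (simp add: sy T_def)
      moreover have "a * T = y\<^sup>2 / (2 * \<gamma>)"
        by (simp add: T_def a_def power2_eq_square flip: abs_mult)
      ultimately show ?thesis
        by (simp add: \<psi>_def A_def flip: of_real_mult times_divide_eq_right)
    qed
    finally show "cmod (G (w + \<i> * (y / (2 * \<gamma>))) - G w
        - F w * exp (\<i> * w * y) * (\<i> * (1 - exp (- (y\<^sup>2 / (2 * \<gamma>)))) / y)) \<le> 4 * M / y\<^sup>2"
      by simp
  qed
qed

text \<open>Serves both horizontal sides of the rectangle: \<open>c = 0\<close> for the original
  segment and \<open>c = \<i> * s\<close> for the shifted one.\<close>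

lemma horizontal_integral:
  fixes F G :: "complex \<Rightarrow> complex"
  assumes "\<And>z. (G has_field_derivative F z) (at z)" "a \<le> b"
  shows "((\<lambda>x. F (of_real x + c)) has_integral G (of_real b + c) - G (of_real a + c)) {a..b}"
proof (rule fundamental_theorem_of_calculus[OF assms(2)])
  fix x
  have "((\<lambda>x. of_real x + c) has_vector_derivative 1) (at x)"
    by (auto intro!: derivative_eq_intros simp: has_vector_derivative_def fun_eq_iff scaleR_conv_of_real)
  from field_vector_diff_chain_at[OF this assms(1)]
  show "((\<lambda>x. G (of_real x + c)) has_vector_derivative F (of_real x + c)) (at x within {a..b})"
    by (simp add: o_def has_vector_derivative_at_within)
qed

text \<open>Conjugation passes through the integral, fixes the real factor \<open>h y\<close> and
  flips the sign of the exponent.\<close>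

lemma fourier_transform_cnj:
  "fourier_transform h (- complex_of_real x) = cnj (fourier_transform h (complex_of_real x))"
  unfolding fourier_transform_def
  by (subst Bochner_Integration.integral_cnj[symmetric]) (simp add: exp_cnj)

theorem proposition3p4:
  fixes h :: "real \<Rightarrow> real" and hhat :: "complex \<Rightarrow> complex" and C \<gamma> :: real
  assumes h_L1: "integrable lebesgue h"
    and hhat_entire: "hhat holomorphic_on UNIV"
    and hhat_extends: "\<And>x::real. hhat (complex_of_real x) = fourier_transform h (complex_of_real x)"
    and C_pos: "C > 0" and \<gamma>_pos: "\<gamma> > 0"
    and hhat_bound: "\<And>u::complex. cmod (hhat u) \<le> C * exp (- \<gamma> * ((Re u)\<^sup>2 - (Im u)\<^sup>2))"
  shows "\<forall>r>0. \<exists>E :: real \<Rightarrow> real. \<exists>K::real. \<forall>y. y \<noteq> 0 \<longrightarrow>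
           \<bar>E y\<bar> \<le> K / y\<^sup>2 \<and>
           cmod (truncated_inverse_fourier r hhat y)
             \<le> C / (2 * sqrt (pi * \<gamma>)) * exp (- (y\<^sup>2 / (4 * \<gamma>)))
               + 1 / pi * \<bar>Im (exp (\<i> * complex_of_real r * complex_of_real y) * hhat (complex_of_real r))\<bar> * (1 / \<bar>y\<bar>)
               + E y"
proof (intro allI impI)
  fix r :: real
  assume r: "r > 0"
  have vb: "cmod (hhat (complex_of_real x + \<i> * t)) \<le> C * exp (\<gamma> * t\<^sup>2)" for x t :: real
  proof -
    have "C * exp (- \<gamma> * (x\<^sup>2 - t\<^sup>2)) \<le> C * exp (\<gamma> * t\<^sup>2)"
      using C_pos \<gamma>_pos by (simp add: algebra_simps)
    then show ?thesis using hhat_bound[of "complex_of_real x + \<i> * t"] by simp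
  qed
  \<comment> \<open>\<open>V\<close> is the error made on a vertical side by freezing
    \<open>hhat\<close> at the endpoint \<open>w\<close>. The primitive \<open>G\<close> stays an
    argument because it depends on \<open>y\<close>, whereas the bounds \<open>M\<close> below are
    to depend on the endpoint only.\<close>
  define V where "V G w y = G (w + \<i> * (y / (2 * \<gamma>))) - G w
        - hhat w * exp (\<i> * w * y) * (\<i> * (1 - exp (- (y\<^sup>2 / (2 * \<gamma>)))) / y)" for G w and y :: real
  have "\<exists>M. \<forall>(y::real) G. y \<noteq> 0 \<longrightarrow> (\<forall>z. (G has_field_derivative hhat z * exp (\<i> * z * y)) (at z)) \<longrightarrow>
      cmod (V G (of_real x) y) \<le> M / y\<^sup>2" for x :: real
    using vertical_side_bound[OF _ hhat_entire \<gamma>_pos vb[of x]] unfolding V_def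
    by (metis Im_complex_of_real)
  then obtain M where M: "\<And>(x::real) (y::real) G. y \<noteq> 0 \<Longrightarrow>
      (\<And>z. (G has_field_derivative hhat z * exp (\<i> * z * y)) (at z)) \<Longrightarrow>
      cmod (V G (of_real x) y) \<le> M x / y\<^sup>2"
    by metis
  \<comment> \<open>The absolute value makes \<open>K\<close> nonnegative, so that
    \<open>K / y\<^sup>2\<close> can itself serve as the error term \<open>E y\<close>.\<close>
  define K where "K = \<bar>(M r + M (- r)) / (2 * pi)\<bar>"
  show "\<exists>E :: real \<Rightarrow> real. \<exists>K::real. \<forall>y. y \<noteq> 0 \<longrightarrow>
           \<bar>E y\<bar> \<le> K / y\<^sup>2 \<and>
           cmod (truncated_inverse_fourier r hhat y)
             \<le> C / (2 * sqrt (pi * \<gamma>)) * exp (- (y\<^sup>2 / (4 * \<gamma>)))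
               + 1 / pi * \<bar>Im (exp (\<i> * complex_of_real r * complex_of_real y) * hhat (complex_of_real r))\<bar> * (1 / \<bar>y\<bar>)
               + E y"
  proof (rule exI[of _ "\<lambda>y. K / y\<^sup>2"], rule exI[of _ K], intro allI impI conjI)
    fix y :: real
    show "\<bar>K / y\<^sup>2\<bar> \<le> K / y\<^sup>2" by (simp add: K_def)
  next
    fix y :: real
    assume y: "y \<noteq> 0"
    define F where "F z = hhat z * exp (\<i> * z * y)" for z
    have "F holomorphic_on UNIV"
      unfolding F_def by (intro holomorphic_intros hhat_entire)
    \<comment> \<open>A global primitive takes the place of a contour integral: shifting the segment
      becomes a telescoping identity between the values of \<open>G\<close> at the four
      corners.\<close>
    then obtain G where G: "\<And>z. (G has_field_derivative F z) (at z)"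
      using holomorphic_convex_primitive'[of UNIV F] by auto
    define s where "s = y / (2 * \<gamma>)"
    define A where "A = exp (\<i> * r * y) * hhat r"
    define q where "q = 1 - exp (- (y\<^sup>2 / (2 * \<gamma>)))"

    have I: "truncated_inverse_fourier r hhat y = (G r - G (- r)) / (2 * pi)"
    proof -
      have "continuous_on {-r..r} (\<lambda>u. F (complex_of_real u))"
        by (intro continuous_on_compose2[OF holomorphic_on_imp_continuous_on[OF \<open>F holomorphic_on UNIV\<close>]]
            continuous_intros) auto
      then have "(LINT u:{-r..r}|lebesgue. F (complex_of_real u)) = integral {-r..r} (\<lambda>u. F (complex_of_real u))"
        by (intro set_lebesgue_integral_eq_integral absolutely_integrable_continuous_real)
      also have "\<dots> = G r - G (- r)"
        using horizontal_integral[OF G, of "- r" r 0] r by (simp add: integral_unique)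
      finally show ?thesis
        by (simp add: truncated_inverse_fourier_def F_def)
    qed

    have top: "cmod (G (of_real r + \<i> * s) - G (of_real (- r) + \<i> * s))
        \<le> C * exp (- (y\<^sup>2 / (4 * \<gamma>))) * sqrt (pi / \<gamma>)"
    proof -
      have hi: "((\<lambda>x. F (of_real x + \<i> * s)) has_integral
          G (of_real r + \<i> * s) - G (of_real (- r) + \<i> * s)) {-r..r}"
        using r by (intro horizontal_integral[OF G]) auto
      have bound: "cmod (F (of_real x + \<i> * s)) \<le> C * exp (- (y\<^sup>2 / (4 * \<gamma>))) * exp (- \<gamma> * x\<^sup>2)" for x
      proof -
        have e: "\<gamma> * s\<^sup>2 - s * y = - (y\<^sup>2 / (4 * \<gamma>))"
          using \<gamma>_pos by (simp add: s_def field_simps power2_eq_square)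
        have "cmod (F (of_real x + \<i> * s)) = cmod (hhat (of_real x + \<i> * s)) * exp (- (s * y))"
          by (simp add: F_def norm_mult norm_exp_eq_Re)
        also have "\<dots> \<le> C * exp (- \<gamma> * (x\<^sup>2 - s\<^sup>2)) * exp (- (s * y))"
          using hhat_bound[of "of_real x + \<i> * s"] by (intro mult_right_mono) auto
        also have "\<dots> = C * exp ((\<gamma> * s\<^sup>2 - s * y) + (- \<gamma> * x\<^sup>2))"
          unfolding mult.assoc exp_add[symmetric] by (simp add: algebra_simps)
        finally show ?thesis unfolding e exp_add by (simp add: mult.assoc)
      qed
      have "cmod (G (of_real r + \<i> * s) - G (of_real (- r) + \<i> * s))
          \<le> integral {-r..r} (\<lambda>x. C * exp (- (y\<^sup>2 / (4 * \<gamma>))) * exp (- \<gamma> * x\<^sup>2))"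
        unfolding integral_unique[OF hi, symmetric]
      proof (rule Henstock_Kurzweil_Integration.integral_norm_bound_integral[OF has_integral_integrable[OF hi] _ bound])
        show "(\<lambda>x. C * exp (- (y\<^sup>2 / (4 * \<gamma>))) * exp (- \<gamma> * x\<^sup>2)) integrable_on {-r..r}"
          by (intro integrable_continuous_real continuous_intros)
      qed
      also have "\<dots> = C * exp (- (y\<^sup>2 / (4 * \<gamma>))) * integral {-r..r} (\<lambda>x. exp (- \<gamma> * x\<^sup>2))"
        by simp
      also have "\<dots> \<le> C * exp (- (y\<^sup>2 / (4 * \<gamma>))) * sqrt (pi / \<gamma>)"
        using gaussian_integral_le[OF \<gamma>_pos] C_pos by (intro mult_left_mono) auto
      finally show ?thesis .
    qed

    have V: "cmod (V G (of_real x) y) \<le> M x / y\<^sup>2" for x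
      using M[OF y] G unfolding F_def by blast
    \<comment> \<open>At real arguments \<open>hhat\<close> is the Fourier transform of a real
      function, so the integrand at \<open>- r\<close> is the conjugate of that at
      \<open>r\<close>.\<close>
    have cA: "exp (\<i> * (- of_real r) * y) * hhat (- of_real r) = cnj A"
      using hhat_extends[of r] hhat_extends[of "- r"] fourier_transform_cnj[of h r]
      by (simp add: A_def exp_cnj)
    \<comment> \<open>The right side is subtracted and the left side added, so the two endpoint
      terms combine into \<open>A - cnj A\<close>, which is \<open>2 * \<i> * Im A\<close>.\<close>
    have dec: "G r - G (- r) = (G (of_real r + \<i> * s) - G (of_real (- r) + \<i> * s))
        - (A - cnj A) * (\<i> * q / y) - V G (of_real r) y + V G (of_real (- r)) y"
    proof -
      have "V G (of_real r) y = G (of_real r + \<i> * s) - G r - A * (\<i> * q / y)"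
        unfolding V_def A_def s_def q_def by (simp only: mult_ac)
      moreover have "V G (of_real (- r)) y = G (of_real (- r) + \<i> * s) - G (- r) - cnj A * (\<i> * q / y)"
        unfolding V_def cA[symmetric] s_def q_def by (simp only: of_real_minus mult_ac)
      ultimately show ?thesis by (simp only: left_diff_distrib) simp
    qed
    have main: "cmod ((A - cnj A) * (\<i> * q / y)) \<le> 2 * \<bar>Im A\<bar> / \<bar>y\<bar>"
    proof -
      \<comment> \<open>\<open>q\<close> is 1 minus the exponential left over at the far end of the
        vertical side; its exponent is nonpositive, so \<open>q\<close> lies between 0 and
        1.\<close>
      have "\<bar>q\<bar> \<le> 1" using \<gamma>_pos by (simp add: q_def)
      then have "2 * \<bar>Im A\<bar> * (\<bar>q\<bar> / \<bar>y\<bar>) \<le> 2 * \<bar>Im A\<bar> * (1 / \<bar>y\<bar>)"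
        by (intro mult_left_mono divide_right_mono) auto
      then show ?thesis
        by (simp add: complex_diff_cnj norm_mult norm_divide abs_mult del: of_real_mult)
    qed
    have "cmod (G r - G (- r)) \<le> C * exp (- (y\<^sup>2 / (4 * \<gamma>))) * sqrt (pi / \<gamma>)
        + 2 * \<bar>Im A\<bar> / \<bar>y\<bar> + M r / y\<^sup>2 + M (- r) / y\<^sup>2"
      unfolding dec using top main V[of r] V[of "- r"]
      by (smt (verit) norm_triangle_ineq norm_triangle_ineq4)
    then have "cmod (G r - G (- r)) / (2 * pi) \<le> (C * exp (- (y\<^sup>2 / (4 * \<gamma>))) * sqrt (pi / \<gamma>)
        + 2 * \<bar>Im A\<bar> / \<bar>y\<bar> + M r / y\<^sup>2 + M (- r) / y\<^sup>2) / (2 * pi)"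
      by (intro divide_right_mono) auto
    also have "\<dots> = C / (2 * sqrt (pi * \<gamma>)) * exp (- (y\<^sup>2 / (4 * \<gamma>))) + 1 / pi * \<bar>Im A\<bar> * (1 / \<bar>y\<bar>)
        + ((M r + M (- r)) / (2 * pi)) / y\<^sup>2"
    proof -
      have "sqrt (pi / \<gamma>) / (2 * pi) = 1 / (2 * sqrt (pi * \<gamma>))"
        using \<gamma>_pos by (simp add: real_sqrt_divide real_sqrt_mult field_simps)
      then have "C * exp (- (y\<^sup>2 / (4 * \<gamma>))) * (sqrt (pi / \<gamma>) / (2 * pi))
          = C / (2 * sqrt (pi * \<gamma>)) * exp (- (y\<^sup>2 / (4 * \<gamma>)))" by simp
      then show ?thesis by (simp add: add_divide_distrib mult.commute)
    qed
    also have "\<dots> \<le> C / (2 * sqrt (pi * \<gamma>)) * exp (- (y\<^sup>2 / (4 * \<gamma>))) + 1 / pi * \<bar>Im A\<bar> * (1 / \<bar>y\<bar>) + K / y\<^sup>2"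
      unfolding K_def by (intro add_left_mono divide_right_mono abs_ge_self) auto
    finally show "cmod (truncated_inverse_fourier r hhat y)
             \<le> C / (2 * sqrt (pi * \<gamma>)) * exp (- (y\<^sup>2 / (4 * \<gamma>)))
               + 1 / pi * \<bar>Im (exp (\<i> * complex_of_real r * complex_of_real y) * hhat (complex_of_real r))\<bar> * (1 / \<bar>y\<bar>)
               + K / y\<^sup>2"
      unfolding I A_def by (simp add: norm_divide)
  qed
qed

end
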